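(* Let $G$ be a graph on $n$ vertices with maximum degree $\Delta$ and minimum degree $\delta$, and let $\overline{G}$ be its complement. Let $t>2$ be a real number. If $n\ge \frac{11t^2+8t+4}{(t-2)^2}$ and $\Delta-\delta\le n/t$, then for each $k\in\{1,2,\dots,n-2\}$, $$s_k(G)+s_k(\overline{G})<\binom{n}{2}+2\binom{k+1}{2}.$$
   Context: All graphs are finite, simple and undirected. For a graph $H$ on $n$ vertices, $L(H)=D(H)-A(H)$ is its Laplacian matrix with eigenvalues $\mu_1(H)\ge\dots\ge\mu_n(H)$, and $s_k(H)=\sum_{i=1}^k\mu_i(H)$. $\overline{G}$ denotes the complement of $G$. *)

theory Defs
  imports
    "Graph_Theory.Pair_Digraph"
    "Jordan_Normal_Form.Char_Poly"
    "Jordan_Normal_Form.Schur_Decomposition"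
begin

text \<open>
  A finite simple undirected graph is a \<open>pair_graph\<close>: a finite, loop-free digraph
  without multiple arcs whose arc set is symmetric.  An edge \<open>{u, v}\<close> is represented by
  the two arcs \<open>(u, v)\<close> and \<open>(v, u)\<close>, so the degree of a vertex in the undirected sense
  is its out-degree.
\<close>

definition vert_degree :: "'a pair_pre_digraph \<Rightarrow> 'a \<Rightarrow> nat" where
  "vert_degree G v = out_degree (with_proj G) v"

definition max_degree :: "'a pair_pre_digraph \<Rightarrow> nat" where
  "max_degree G = Max (vert_degree G ` pverts G)"

definition min_degree :: "'a pair_pre_digraph \<Rightarrow> nat" where
  "min_degree G = Min (vert_degree G ` pverts G)"

definition graph_complement :: "'a pair_pre_digraph \<Rightarrow> 'a pair_pre_digraph" where
  "graph_complement G =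
     \<lparr> pverts = pverts G,
       parcs = {(u, v). u \<in> pverts G \<and> v \<in> pverts G \<and> u \<noteq> v \<and> (u, v) \<notin> parcs G} \<rparr>"

lemma pair_graph_complement:
  assumes "pair_graph G"
  shows "pair_graph (graph_complement G)"
proof -
  interpret pair_graph G by fact
  have s: "(u, v) \<in> parcs G \<longleftrightarrow> (v, u) \<in> parcs G" for u v
    using pair_sym_arcs by (auto simp: symmetric_def elim: symE)
  have "finite (parcs (graph_complement G))"
    by (rule finite_subset[of _ "pverts G \<times> pverts G"])
       (auto simp: graph_complement_def pair_finite_verts)
  then show ?thesis
    by unfold_locales
       (auto simp: graph_complement_def pair_finite_verts symmetric_def sym_def s)
qed

text \<open>
  The matrices of a graph are taken with respect to an enumeration
  \<open>f 0, \<dots>, f (n - 1)\<close> of its vertices.  Lemma \<open>char_poly_laplacian_mat\<close> below shows that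
  the choice of \<open>f\<close> does not affect the spectrum.
\<close>

definition adjacency_mat :: "(nat \<Rightarrow> 'a) \<Rightarrow> 'a pair_pre_digraph \<Rightarrow> real mat" where
  "adjacency_mat f G =
     (let n = card (pverts G) in mat n n (\<lambda>(i, j). if (f i, f j) \<in> parcs G then 1 else 0))"

definition degree_mat :: "(nat \<Rightarrow> 'a) \<Rightarrow> 'a pair_pre_digraph \<Rightarrow> real mat" where
  "degree_mat f G =
     (let n = card (pverts G) in
        mat n n (\<lambda>(i, j). if i = j then real (vert_degree G (f i)) else 0))"

definition laplacian_mat :: "(nat \<Rightarrow> 'a) \<Rightarrow> 'a pair_pre_digraph \<Rightarrow> real mat" where
  "laplacian_mat f G = degree_mat f G - adjacency_mat f G"

definition vertex_enum :: "'a pair_pre_digraph \<Rightarrow> nat \<Rightarrow> 'a" where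
  "vertex_enum G = (SOME f. bij_betw f {..<card (pverts G)} (pverts G))"

definition laplacian :: "'a pair_pre_digraph \<Rightarrow> real mat" where
  "laplacian G = laplacian_mat (vertex_enum G) G"

text \<open>
  The eigenvalues in non-increasing order, repeated according to their multiplicity as
  roots of the characteristic polynomial.  Since the Laplacian is real symmetric, all
  \<open>n\<close> of them are real; see \<open>length_laplacian_eigenvalues\<close>.
\<close>

definition laplacian_eigenvalues :: "'a pair_pre_digraph \<Rightarrow> real list" where
  "laplacian_eigenvalues G =
     rev (sorted_list_of_multiset (proots (char_poly (laplacian G))))"

text \<open>The index \<open>i\<close> of \<open>mu G i\<close> ranges over \<open>1, \<dots>, n\<close>, whereas list indices start at \<open>0\<close>.\<close>

definition mu :: "'a pair_pre_digraph \<Rightarrow> nat \<Rightarrow> real" where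
  "mu G i = laplacian_eigenvalues G ! (i - 1)"

definition laplacian_sum :: "nat \<Rightarrow> 'a pair_pre_digraph \<Rightarrow> real" where
  "laplacian_sum k G = (\<Sum>i = 1..k. mu G i)"

lemma bij_betw_vertex_enum:
  assumes "pair_graph G"
  shows "bij_betw (vertex_enum G) {..<card (pverts G)} (pverts G)"
proof -
  interpret pair_graph G by fact
  have "\<exists>f. bij_betw f {..<card (pverts G)} (pverts G)"
    using ex_bij_betw_nat_finite[OF pair_finite_verts] by (simp add: atLeast0LessThan)
  then show ?thesis
    unfolding vertex_enum_def by (rule someI_ex)
qed

lemma laplacian_mat_carrier:
  "laplacian_mat f G \<in> carrier_mat (card (pverts G)) (card (pverts G))"
  unfolding laplacian_mat_def degree_mat_def adjacency_mat_def Let_def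
  by (intro minus_carrier_mat mat_carrier)

lemma laplacian_mat_index:
  assumes "i < card (pverts G)" "j < card (pverts G)"
  shows "laplacian_mat f G $$ (i, j) =
    (if i = j then real (vert_degree G (f i)) else 0) -
    (if (f i, f j) \<in> parcs G then 1 else 0)"
  using assms by (simp add: laplacian_mat_def degree_mat_def adjacency_mat_def Let_def)

lemma char_poly_laplacian_mat:
  assumes "bij_betw f {..<card (pverts G)} (pverts G)"
    and "bij_betw g {..<card (pverts G)} (pverts G)"
  shows "char_poly (laplacian_mat f G) = char_poly (laplacian_mat g G)"
proof -
  define n where "n = card (pverts G)"
  define p where "p i = (if i < n then inv_into {..<n} g (f i) else i)" for i
  have "bij_betw (inv_into {..<n} g \<circ> f) {..<n} {..<n}"
    using assms bij_betw_inv_into bij_betw_trans unfolding n_def by blast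
  then have bp: "bij_betw p {..<n} {..<n}"
    by (subst bij_betw_cong[of _ _ "inv_into {..<n} g \<circ> f"]) (auto simp: p_def)
  have gp: "g (p i) = f i" if "i < n" for i
  proof -
    have "f i \<in> g ` {..<n}"
      using assms that by (auto simp: bij_betw_def n_def)
    then show ?thesis
      using that by (simp add: p_def f_inv_into_f)
  qed
  have plt: "p i < n" if "i < n" for i
    using bp that by (auto simp: bij_betw_def)
  have pinj: "p i = p j \<longleftrightarrow> i = j" if "i < n" "j < n" for i j
    using bp that by (auto simp: bij_betw_def inj_on_def)
  define P :: "real mat" where "P = mat n n (\<lambda>(i, j). if j = p i then 1 else 0)"
  define Q :: "real mat" where "Q = mat n n (\<lambda>(i, j). if i = p j then 1 else 0)"
  have C: "P \<in> carrier_mat n n" "Q \<in> carrier_mat n n"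
    by (auto simp: P_def Q_def)
  have L: "laplacian_mat f G \<in> carrier_mat n n" "laplacian_mat g G \<in> carrier_mat n n"
    unfolding n_def by (rule laplacian_mat_carrier)+
  have PQ: "P * Q = 1\<^sub>m n"
  proof (rule eq_matI)
    fix i j assume ij: "i < dim_row (1\<^sub>m n)" "j < dim_col (1\<^sub>m n)"
    have "(P * Q) $$ (i, j) =
      (\<Sum>k\<in>{0..<n}. (if k = p i then 1 else 0) * (if k = p j then 1 else 0))"
      using ij by (simp add: P_def Q_def scalar_prod_def)
    also have "\<dots> = (if p i = p j then 1 else 0)"
      using ij plt by (simp add: if_distrib[of "\<lambda>x. x * _"] cong: if_cong)
    finally show "(P * Q) $$ (i, j) = 1\<^sub>m n $$ (i, j)"
      using ij pinj by simp
  qed (use C in auto)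
  have QP: "Q * P = 1\<^sub>m n"
    using mat_mult_left_right_inverse[OF C PQ] .
  have "laplacian_mat f G = P * laplacian_mat g G * Q"
  proof (rule eq_matI)
    fix i j assume "i < dim_row (P * laplacian_mat g G * Q)"
      "j < dim_col (P * laplacian_mat g G * Q)"
    then have ij: "i < n" "j < n"
      by (auto simp: P_def Q_def)
    have PL: "(P * laplacian_mat g G) $$ (i, k) = laplacian_mat g G $$ (p i, k)"
      if "k < n" for k
    proof -
      have "(P * laplacian_mat g G) $$ (i, k) =
        (\<Sum>l\<in>{0..<n}. (if l = p i then 1 else 0) * laplacian_mat g G $$ (l, k))"
        using ij that L(2) by (simp add: P_def scalar_prod_def)
      then show ?thesis
        using ij plt by (simp add: if_distrib[of "\<lambda>x. x * _"] cong: if_cong)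
    qed
    have "(P * laplacian_mat g G * Q) $$ (i, j) =
      (\<Sum>k\<in>{0..<n}. (P * laplacian_mat g G) $$ (i, k) * Q $$ (k, j))"
      using ij L(2) C by (simp add: scalar_prod_def del: assoc_mult_mat)
    also have "\<dots> = (\<Sum>k\<in>{0..<n}. laplacian_mat g G $$ (p i, k) * (if k = p j then 1 else 0))"
      using ij by (intro sum.cong) (auto simp: PL Q_def)
    also have "\<dots> = laplacian_mat g G $$ (p i, p j)"
      using ij plt by (simp add: if_distrib[of "\<lambda>x. _ * x"] cong: if_cong)
    also have "\<dots> = laplacian_mat f G $$ (i, j)"
      using ij plt[of i] plt[of j] pinj gp
      by (simp add: laplacian_mat_index flip: n_def)
    finally show "laplacian_mat f G $$ (i, j) = (P * laplacian_mat g G * Q) $$ (i, j)" ..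
  qed (use C L in auto)
  then have "similar_mat (laplacian_mat f G) (laplacian_mat g G)"
    unfolding similar_mat_def similar_mat_wit_def
    using C L PQ QP by (intro exI[of _ P] exI[of _ Q]) (auto simp: Let_def)
  then show ?thesis
    by (rule char_poly_similar)
qed

lemma real_symmetric_eigenvalue_real:
  fixes A :: "real mat" and x :: complex
  assumes A: "A \<in> carrier_mat n n"
    and sym: "\<And>i j. i < n \<Longrightarrow> j < n \<Longrightarrow> A $$ (i, j) = A $$ (j, i)"
    and ev: "eigenvalue (map_mat complex_of_real A) x"
  shows "x \<in> \<real>"
proof -
  define B where "B = map_mat complex_of_real A"
  have B: "B \<in> carrier_mat n n"
    using A by (simp add: B_def)
  obtain v where v: "v \<in> carrier_vec n" "v \<noteq> 0\<^sub>v n" "B *\<^sub>v v = x \<cdot>\<^sub>v v"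
    using ev B unfolding B_def[symmetric] eigenvalue_def eigenvector_def by auto
  define N where "N = (\<Sum>i<n. v $ i * cnj (v $ i))"
  have row: "(\<Sum>j<n. of_real (A $$ (i, j)) * v $ j) = x * v $ i" if "i < n" for i
  proof -
    have "(B *\<^sub>v v) $ i = (\<Sum>j<n. of_real (A $$ (i, j)) * v $ j)"
      using that A v(1) by (simp add: B_def scalar_prod_def atLeast0LessThan)
    then show ?thesis
      using that v by simp
  qed
  define S where "S = (\<Sum>i<n. \<Sum>j<n. of_real (A $$ (i, j)) * v $ j * cnj (v $ i))"
  have S: "S = x * N"
    unfolding S_def N_def sum_distrib_left
    by (intro sum.cong refl) (simp add: row flip: mult.assoc sum_distrib_right)
  have "cnj S = (\<Sum>i<n. \<Sum>j<n. of_real (A $$ (i, j)) * cnj (v $ j) * v $ i)"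
    by (simp add: S_def)
  also have "\<dots> = (\<Sum>j<n. \<Sum>i<n. of_real (A $$ (i, j)) * cnj (v $ j) * v $ i)"
    by (rule sum.swap)
  also have "\<dots> = S"
    unfolding S_def by (intro sum.cong refl) (simp add: sym mult_ac)
  finally have cS: "cnj S = S" .
  have N: "N = of_real (\<Sum>i<n. (cmod (v $ i))\<^sup>2)"
    unfolding N_def of_real_sum complex_norm_square ..
  obtain i where "i < n" "v $ i \<noteq> 0"
    using v by (metis carrier_vecD eq_vecI index_zero_vec)
  then have "(\<Sum>i<n. (cmod (v $ i))\<^sup>2) > 0"
    by (intro sum_pos2[of _ i]) auto
  then have "N \<noteq> 0" "cnj N = N"
    unfolding N by (simp_all del: of_real_sum of_real_power)
  then have "cnj x = x"
    using cS S by simp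
  then show ?thesis
    by (simp add: Reals_cnj_iff)
qed

lemma size_proots_symmetric:
  fixes A :: "real mat"
  assumes A: "A \<in> carrier_mat n n"
    and sym: "\<And>i j. i < n \<Longrightarrow> j < n \<Longrightarrow> A $$ (i, j) = A $$ (j, i)"
  shows "size (proots (char_poly A)) = n"
proof -
  let ?c = complex_of_real
  interpret mp: map_poly_comm_ring_hom ?c ..
  have cA: "map_mat ?c A \<in> carrier_mat n n"
    using A by simp
  obtain as where as: "char_poly (map_mat ?c A) = (\<Prod>a\<leftarrow>as. [:- a, 1:])" "length as = n"
    using char_poly_factorized[OF cA] by blast
  have real: "a \<in> \<real>" if "a \<in> set as" for a
  proof (rule real_symmetric_eigenvalue_real[OF A sym])
    have "poly (char_poly (map_mat ?c A)) a = 0"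
      using that unfolding as(1) poly_prod_list by (auto simp: prod_list_zero_iff)
    then show "eigenvalue (map_mat ?c A) a"
      by (simp add: eigenvalue_root_char_poly[OF cA])
  qed
  define bs where "bs = map Re as"
  have asb: "as = map ?c bs"
    using real by (simp add: bs_def o_def map_idI)
  have "map_poly ?c (char_poly A) = (\<Prod>a\<leftarrow>as. [:- a, 1:])"
    using as(1) of_real_hom.char_poly_hom[OF A] by metis
  also have "\<dots> = map_poly ?c (\<Prod>b\<leftarrow>bs. [:- b, 1:])"
    unfolding asb
    by (induction bs) (simp_all add: mp.hom_mult of_real_hom.map_poly_pCons_hom del: mult_pCons_left)
  finally have "char_poly A = (\<Prod>b\<leftarrow>bs. [:- b, 1:])"
    by (metis (no_types, lifting) poly_eqI coeff_map_poly of_real_0 of_real_eq_iff)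
  moreover have "proots (\<Prod>b\<leftarrow>bs. [:- b, 1:]) = mset bs"
  proof (induction bs)
    case (Cons b bs)
    have "(\<Prod>b\<leftarrow>bs. [:- b, 1:]) \<noteq> 0"
      by (auto simp: prod_list_zero_iff)
    then have "proots ([:- b, 1:] * (\<Prod>b\<leftarrow>bs. [:- b, 1:])) = {#b#} + mset bs"
      using Cons by (subst proots_mult) simp_all
    then show ?case
      by (simp del: mult_pCons_left)
  qed simp
  ultimately have "proots (char_poly A) = mset bs"
    by simp
  then show ?thesis
    using as(2) asb by simp
qed

lemma length_laplacian_eigenvalues:
  assumes "pair_graph G"
  shows "length (laplacian_eigenvalues G) = card (pverts G)"
proof -
  interpret pair_graph G by fact
  have s: "(u, v) \<in> parcs G \<longleftrightarrow> (v, u) \<in> parcs G" for u v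
    using pair_sym_arcs by (auto simp: symmetric_def elim: symE)
  have "size (proots (char_poly (laplacian G))) = card (pverts G)"
    unfolding laplacian_def
    by (rule size_proots_symmetric[OF laplacian_mat_carrier])
       (auto simp: laplacian_mat_index s)
  then show ?thesis
    by (simp add: laplacian_eigenvalues_def flip: size_mset)
qed

end

theory Submission
  imports Defs "HOL-Analysis.Convex"
begin

text \<open>
  The spectrum of \<open>G\<close> is \<open>a 0 \<le> \<dots> \<le> a (m - 1)\<close> together with \<open>0\<close>, where \<open>m = n - 1\<close>, and that
  of the complement is obtained by \<open>a i \<mapsto> n - a i\<close>.  So the two sums add up to \<open>n k + F k\<close> with
  \<open>F k = (\<Sum>i<k. a (m - 1 - i) - a i)\<close>.  The claim \<open>k (m - k) + F k < m (m + 1) / 2\<close> is invariant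
  under \<open>k \<mapsto> m - k\<close>, hence we may assume \<open>2 k \<le> m\<close>, and then Cauchy-Schwarz gives
  \<open>(F k)\<^sup>2 \<le> m V\<close> where \<open>V\<close> is the sum of squared deviations of the \<open>a i\<close> from their mean.
  The traces of \<open>L\<close> and \<open>L\<^sup>2\<close> express \<open>V\<close> by the degrees, and as these lie in an interval of
  length at most \<open>n / t\<close>, it is at most \<open>n\<^sup>3 / (4 t\<^sup>2) + n (n - 1) / 4\<close>.  This makes \<open>F k\<close>
  smaller than \<open>m (m + 2) / 4\<close>, while \<open>k (m - k) \<le> m\<^sup>2 / 4\<close>.
\<close>

subsection \<open>Real-rooted characteristic polynomials and traces\<close>

text \<open>Each root splits off one linear factor and takes one element out of
  \<open>proots\<close>, so a full count of roots leaves only the leading coefficient. It turns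
  \<open>size_proots_symmetric\<close> into the factorized form that Schur decomposition asks
  for.\<close>

lemma poly_splits_if_size_proots:
  fixes p :: "'a :: field poly"
  assumes "size (proots p) = degree p"
  shows "\<exists>es. p = smult (lead_coeff p) (\<Prod>a\<leftarrow>es. [:- a, 1:])"
  using assms
proof (induction "degree p" arbitrary: p)
  case 0
  then obtain c where "p = [:c:]"
    by (metis degree_eq_zeroE)
  then show ?case
    by (intro exI[of _ "[]"]) simp
next
  case (Suc m)
  then have "p \<noteq> 0" "proots p \<noteq> {#}"
    by auto
  then obtain a where "a \<in># proots p"
    by blast
  with \<open>p \<noteq> 0\<close> have "poly p a = 0"
    by simp
  then obtain q where q: "p = [:- a, 1:] * q"
    using poly_eq_0_iff_dvd by (metis dvdE)
  with \<open>p \<noteq> 0\<close> have "q \<noteq> 0"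
    by auto
  have deg: "degree p = Suc (degree q)"
    unfolding q using \<open>q \<noteq> 0\<close> by (subst degree_mult_eq) auto
  have "proots p = {#a#} + proots q"
    unfolding q using \<open>q \<noteq> 0\<close> by (subst proots_mult) auto
  with Suc.prems deg have "size (proots q) = degree q"
    by simp
  moreover have "m = degree q"
    using Suc.hyps(2) deg by simp
  ultimately obtain es where es: "q = smult (lead_coeff q) (\<Prod>a\<leftarrow>es. [:- a, 1:])"
    using Suc.hyps(1) by blast
  have "lead_coeff p = lead_coeff q"
    unfolding q lead_coeff_mult by simp
  then have "smult (lead_coeff p) (\<Prod>a\<leftarrow>a # es. [:- a, 1:])
      = [:- a, 1:] * smult (lead_coeff q) (\<Prod>a\<leftarrow>es. [:- a, 1:])"
    by (simp del: mult_pCons_left)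
  also have "\<dots> = p"
    by (simp only: es[symmetric] q[symmetric])
  finally show ?case
    by metis
qed

lemma proots_prod_list_linear:
  fixes es :: "'a :: field list"
  shows "proots (\<Prod>a\<leftarrow>es. [:- a, 1:]) = mset es"
proof (induction es)
  case (Cons e es)
  have "(\<Prod>a\<leftarrow>es. [:- a, 1:]) \<noteq> 0"
    by (auto simp: prod_list_zero_iff)
  then have "proots ([:- e, 1:] * (\<Prod>a\<leftarrow>es. [:- a, 1:])) = {#e#} + mset es"
    using Cons by (subst proots_mult) simp_all
  then show ?case
    by (simp del: mult_pCons_left)
qed simp

lemma symmetric_mat_char_poly_splits:
  fixes A :: "real mat"
  assumes A: "A \<in> carrier_mat n n"
    and sym: "\<And>i j. i < n \<Longrightarrow> j < n \<Longrightarrow> A $$ (i, j) = A $$ (j, i)"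
  shows "\<exists>es. char_poly A = (\<Prod>a\<leftarrow>es. [:- a, 1:])"
proof -
  have "degree (char_poly A) = n" "lead_coeff (char_poly A) = 1"
    using degree_monic_char_poly[OF A] by auto
  then show ?thesis
    using poly_splits_if_size_proots[of "char_poly A"] size_proots_symmetric[OF A sym] by simp
qed

section \<open>Traces, similarity and the first two power sums of the eigenvalues\<close>

definition mat_trace :: "'a :: comm_monoid_add mat \<Rightarrow> 'a" where
  "mat_trace A = (\<Sum>i<dim_row A. A $$ (i, i))"

lemma mat_trace_mult:
  assumes A: "A \<in> carrier_mat n m" and B: "B \<in> carrier_mat m n"
  shows "mat_trace (A * B) = (\<Sum>i<n. \<Sum>j<m. A $$ (i, j) * B $$ (j, i))"
  using assms by (simp add: mat_trace_def scalar_prod_def atLeast0LessThan)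

lemma mat_trace_commute:
  fixes A B :: "'a :: comm_semiring_0 mat"
  assumes A: "A \<in> carrier_mat n m" and B: "B \<in> carrier_mat m n"
  shows "mat_trace (A * B) = mat_trace (B * A)"
  unfolding mat_trace_mult[OF A B] mat_trace_mult[OF B A]
  by (subst sum.swap) (simp add: mult.commute)

lemma mat_trace_similar_wit:
  fixes A :: "'a :: comm_ring_1 mat"
  assumes A: "A \<in> carrier_mat n n" and AB: "similar_mat_wit A B P Q"
  shows "mat_trace A = mat_trace B"
proof -
  note w = similar_mat_witD2[OF A AB]
  have "mat_trace A = mat_trace (P * (B * Q))"
    using w by (simp add: assoc_mult_mat[of P n n B n Q n])
  also have "\<dots> = mat_trace (B * Q * P)"
    using w by (intro mat_trace_commute[of _ n n]) auto
  also have "B * Q * P = B"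
    using w by (simp add: assoc_mult_mat[of B n n Q n P n])
  finally show ?thesis .
qed

lemma mat_trace_eq_sum_list_diag:
  "A \<in> carrier_mat n n \<Longrightarrow> mat_trace A = sum_list (diag_mat A)"
  by (simp add: mat_trace_def diag_mat_def sum_list_distinct_conv_sum_set atLeast0LessThan)

lemma upper_triangular_square_diag:
  fixes T :: "'a :: comm_ring_1 mat"
  assumes T: "T \<in> carrier_mat n n" and ut: "upper_triangular T" and i: "i < n"
  shows "(T * T) $$ (i, i) = (T $$ (i, i))\<^sup>2"
proof -
  have "(T * T) $$ (i, i) = (\<Sum>j<n. T $$ (i, j) * T $$ (j, i))"
    using T i by (simp add: scalar_prod_def atLeast0LessThan)
  also have "\<dots> = (\<Sum>j<n. if j = i then (T $$ (i, i))\<^sup>2 else 0)"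
  proof (intro sum.cong refl)
    fix j assume "j \<in> {..<n}"
    then show "T $$ (i, j) * T $$ (j, i) = (if j = i then (T $$ (i, i))\<^sup>2 else 0)"
      using upper_triangularD[OF ut, of i j] upper_triangularD[OF ut, of j i] T i
      by (cases i j rule: linorder_cases) (auto simp: power2_eq_square)
  qed
  finally show ?thesis
    using i by simp
qed

text \<open>Schur decomposition makes \<open>A\<close> similar to an upper triangular
  \<open>T\<close> with diagonal \<open>es\<close>. The trace survives similarity, the same
  witnesses conjugate \<open>A * A\<close> to \<open>T * T\<close>, and the diagonal of
  \<open>T * T\<close> consists of the squares of that of \<open>T\<close>.\<close>

lemma mat_trace_eigenvalues:
  fixes A :: "real mat"
  assumes A: "A \<in> carrier_mat n n" and cp: "char_poly A = (\<Prod>a\<leftarrow>es. [:- a, 1:])"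
  shows "mat_trace A = sum_list es"
    and "mat_trace (A * A) = (\<Sum>a\<leftarrow>es. a\<^sup>2)"
proof -
  obtain T P Q where "schur_decomposition A es = (T, P, Q)"
    by (metis prod_cases3)
  from schur_decomposition[OF A cp this]
  have sim: "similar_mat_wit A T P Q" and ut: "upper_triangular T" and diag: "diag_mat T = es"
    by auto
  note w = similar_mat_witD2[OF A sim]
  have T: "T \<in> carrier_mat n n"
    using w by auto
  show "mat_trace A = sum_list es"
    using mat_trace_similar_wit[OF A sim] mat_trace_eq_sum_list_diag[OF T] diag by simp
  have "similar_mat_wit (A ^\<^sub>m 2) (T ^\<^sub>m 2) P Q"
    using similar_mat_wit_pow[OF sim] .
  then have "similar_mat_wit (A * A) (T * T) P Q"
    using A T by (simp add: numeral_2_eq_2)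
  then have "mat_trace (A * A) = mat_trace (T * T)"
    using A by (intro mat_trace_similar_wit[of _ n]) auto
  also have "\<dots> = (\<Sum>i<n. (T $$ (i, i))\<^sup>2)"
    using T by (auto simp: mat_trace_def upper_triangular_square_diag[OF T ut] simp del: index_mult_mat(1))
  also have "\<dots> = (\<Sum>a\<leftarrow>es. a\<^sup>2)"
    using T unfolding diag[symmetric]
    by (simp add: diag_mat_def o_def sum_list_distinct_conv_sum_set atLeast0LessThan)
  finally show "mat_trace (A * A) = (\<Sum>a\<leftarrow>es. a\<^sup>2)" .
qed

text \<open>The witnesses that triangularize \<open>A\<close> fix scalar matrices, so they also
  triangularize \<open>c\<close> times the identity minus \<open>A\<close>, and the new diagonal can
  be read off. This carries the spectrum of a graph over to its complement.\<close>

lemma char_poly_reflect: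
  fixes A :: "real mat"
  assumes A: "A \<in> carrier_mat n n" and cp: "char_poly A = (\<Prod>a\<leftarrow>es. [:- a, 1:])"
  shows "char_poly (c \<cdot>\<^sub>m 1\<^sub>m n - A) = (\<Prod>a\<leftarrow>es. [:- (c - a), 1:])"
proof -
  obtain T P Q where "schur_decomposition A es = (T, P, Q)"
    by (metis prod_cases3)
  from schur_decomposition[OF A cp this]
  have sim: "similar_mat_wit A T P Q" and ut: "upper_triangular T" and diag: "diag_mat T = es"
    by auto
  note w = similar_mat_witD2[OF A sim]
  let ?S = "c \<cdot>\<^sub>m 1\<^sub>m n - T"
  have T: "T \<in> carrier_mat n n" and P: "P \<in> carrier_mat n n" and Q: "Q \<in> carrier_mat n n"
    using w by auto
  have S: "?S \<in> carrier_mat n n"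
    using T by auto
  have "P * ?S * Q = P * (c \<cdot>\<^sub>m 1\<^sub>m n) * Q - P * T * Q"
    using P Q T
    by (simp add: mult_minus_distrib_mat[of P n n _ n] minus_mult_distrib_mat[of _ n n _ Q n])
  also have "P * (c \<cdot>\<^sub>m 1\<^sub>m n) * Q = c \<cdot>\<^sub>m 1\<^sub>m n"
    using P Q w by (simp add: mult_smult_distrib[of P n n _ n] mult_smult_assoc_mat[of _ n n])
  finally have "P * ?S * Q = c \<cdot>\<^sub>m 1\<^sub>m n - A"
    using w by simp
  then have "similar_mat (c \<cdot>\<^sub>m 1\<^sub>m n - A) ?S"
    using w S A by (intro similar_matI[of _ _ P Q n]) auto
  then have "char_poly (c \<cdot>\<^sub>m 1\<^sub>m n - A) = char_poly ?S"
    by (rule char_poly_similar)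
  also have "\<dots> = (\<Prod>a\<leftarrow>diag_mat ?S. [:- a, 1:])"
    by (intro char_poly_upper_triangular[OF S] upper_triangularI)
       (use T upper_triangularD[OF ut] in auto)
  also have "diag_mat ?S = map (\<lambda>a. c - a) es"
    using T unfolding diag[symmetric] by (auto simp: diag_mat_def)
  finally show ?thesis
    by (simp add: o_def)
qed

text \<open>If \<open>M\<close> annihilates the all-ones vector, this is the matrix of the map that
  \<open>M\<close> induces modulo that vector, in the basis given by all standard unit vectors but
  the first. Subtracting row 0 sends the all-ones matrix to 0, which is what makes a graph and its
  complement comparable.\<close>

definition row_reduced_mat :: "nat \<Rightarrow> real mat \<Rightarrow> real mat" where
  "row_reduced_mat m M = mat m m (\<lambda>(i, j). M $$ (Suc i, Suc j) - M $$ (0, Suc j))"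

lemma row_reduced_mat_carrier: "row_reduced_mat m M \<in> carrier_mat m m"
  by (simp add: row_reduced_mat_def)

text \<open>In a basis that starts with a kernel vector, column 0 of the matrix vanishes; expanding
  along it yields the factor for the eigenvalue 0, and the remaining block is the induced map on the
  quotient.\<close>

lemma char_poly_zero_row_sums:
  fixes M :: "real mat"
  assumes M: "M \<in> carrier_mat (Suc m) (Suc m)"
    and rows: "\<And>i. i < Suc m \<Longrightarrow> (\<Sum>j<Suc m. M $$ (i, j)) = 0"
  shows "char_poly M = monom 1 1 * char_poly (row_reduced_mat m M)"
proof -
  let ?n = "Suc m"
  \<comment> \<open>Change to a basis whose first vector is the all-ones kernel vector.\<close>
  define P :: "real mat" where "P = mat ?n ?n (\<lambda>(i, j). if i = j \<or> j = 0 then 1 else 0)"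
  define Q :: "real mat"
    where "Q = mat ?n ?n (\<lambda>(i, j). if i = j then 1 else if j = 0 then - 1 else 0)"
  \<comment> \<open>\<open>C\<close> is \<open>Q * M * P\<close> written out entrywise; its column 0
    is zero because the rows of \<open>M\<close> sum to 0.\<close>
  define C :: "real mat"
    where "C = mat ?n ?n (\<lambda>(i, j). if j = 0 then 0
      else M $$ (i, j) - (if i = 0 then 0 else M $$ (0, j)))"
  have carr: "P \<in> carrier_mat ?n ?n" "Q \<in> carrier_mat ?n ?n" "C \<in> carrier_mat ?n ?n"
    by (simp_all add: P_def Q_def C_def)
  have Pmult: "(P * X) $$ (i, j) = (if i = 0 then X $$ (0, j) else X $$ (0, j) + X $$ (i, j))"
    if X: "X \<in> carrier_mat ?n ?n" and ij: "i < ?n" "j < ?n" for X i j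
  proof -
    have "(P * X) $$ (i, j) = (\<Sum>k<?n. (if i = k \<or> k = 0 then 1 else 0) * X $$ (k, j))"
      using X ij by (simp add: P_def scalar_prod_def atLeast0LessThan del: sum.lessThan_Suc)
    also have "\<dots> = (\<Sum>k\<in>{0, i}. X $$ (k, j))"
      using ij by (intro sum.mono_neutral_cong_right) auto
    finally show ?thesis
      by auto
  qed
  have PQ: "P * Q = 1\<^sub>m ?n"
  proof (rule eq_matI)
    fix i j assume "i < dim_row (1\<^sub>m ?n :: real mat)" "j < dim_col (1\<^sub>m ?n :: real mat)"
    then show "(P * Q) $$ (i, j) = 1\<^sub>m ?n $$ (i, j)"
      using Pmult[OF carr(2), of i j] by (auto simp: Q_def)
  qed (use carr in auto)
  have MP: "M * P = P * C"
  proof (rule eq_matI)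
    fix i j assume "i < dim_row (P * C)" "j < dim_col (P * C)"
    with carr have ij: "i < ?n" "j < ?n"
      by auto
    have "(M * P) $$ (i, j) = (\<Sum>k<?n. M $$ (i, k) * (if k = j \<or> j = 0 then 1 else 0))"
      using M ij by (simp add: P_def scalar_prod_def atLeast0LessThan del: sum.lessThan_Suc)
    also have "\<dots> = (if j = 0 then 0 else M $$ (i, j))"
      using ij rows[OF ij(1)]
      by (simp add: if_distrib[of "\<lambda>x. _ * x"] del: sum.lessThan_Suc cong: if_cong)
    also have "\<dots> = (P * C) $$ (i, j)"
      using Pmult[OF carr(3) ij] ij by (auto simp: C_def)
    finally show "(M * P) $$ (i, j) = (P * C) $$ (i, j)" .
  qed (use carr M in auto)
  have QP: "Q * P = 1\<^sub>m ?n"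
    using mat_mult_left_right_inverse[OF carr(1,2) PQ] .
  have "M = M * (P * Q)"
    using M by (simp add: PQ)
  also have "\<dots> = P * C * Q"
    using M carr by (simp add: MP flip: assoc_mult_mat[of M ?n ?n P ?n Q ?n])
  finally have "similar_mat M C"
    using M carr PQ QP by (intro similar_matI[of _ _ P Q ?n]) auto
  then have "char_poly M = char_poly C"
    by (rule char_poly_similar)
  also have "\<dots> = monom 1 1 * char_poly (mat_delete C 0 0)"
    by (rule char_poly_0_column[OF _ carr(3)]) (auto simp: C_def)
  also have "mat_delete C 0 0 = row_reduced_mat m M"
    by (rule eq_matI) (auto simp: mat_delete_def C_def row_reduced_mat_def)
  finally show ?thesis .
qed

section \<open>Positive semidefiniteness through the quadratic form\<close>

lemma eigenvalue_nonneg_if_quadratic_form_nonneg: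
  fixes A :: "real mat"
  assumes A: "A \<in> carrier_mat n n"
    and psd: "\<And>v. v \<in> carrier_vec n \<Longrightarrow> v \<bullet> (A *\<^sub>v v) \<ge> 0"
    and root: "poly (char_poly A) e = 0"
  shows "e \<ge> 0"
proof -
  have "eigenvalue A e"
    using root by (simp add: eigenvalue_root_char_poly[OF A])
  then obtain v where v: "v \<in> carrier_vec n" "v \<noteq> 0\<^sub>v n" "A *\<^sub>v v = e \<cdot>\<^sub>v v"
    using A unfolding eigenvalue_def eigenvector_def by auto
  have "0 \<le> e * (v \<bullet> v)"
    using psd[OF v(1)] v by simp
  moreover have "v \<bullet> v > 0"
    using conjugate_square_greater_0_vec[OF v(1)] v(2) by simp
  ultimately show ?thesis
    by (simp add: zero_le_mult_iff)
qed

text \<open>Expanding the square gives two sums of pure squares, equal by symmetry of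
  \<open>a\<close>, and a mixed sum. The division by 2 compensates that the double sum meets every
  pair in both orders.\<close>

lemma laplacian_quadratic_form:
  fixes a :: "nat \<Rightarrow> nat \<Rightarrow> real"
  assumes sym: "\<And>i j. i < n \<Longrightarrow> j < n \<Longrightarrow> a i j = a j i"
  shows "(\<Sum>i<n. \<Sum>j<n. v i * ((if i = j then (\<Sum>l<n. a i l) else 0) - a i j) * v j)
    = (\<Sum>i<n. \<Sum>j<n. a i j * (v i - v j)\<^sup>2) / 2"
proof -
  let ?S = "\<lambda>g. \<Sum>i<n. \<Sum>j<n. a i j * g i j"
  have "(\<Sum>i<n. \<Sum>j<n. v i * ((if i = j then (\<Sum>l<n. a i l) else 0) - a i j) * v j)
    = (\<Sum>i<n. (v i)\<^sup>2 * (\<Sum>l<n. a i l) - (\<Sum>j<n. a i j * (v i * v j)))"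
  proof (intro sum.cong refl)
    fix i assume i: "i \<in> {..<n}"
    have "(\<Sum>j<n. v i * ((if i = j then (\<Sum>l<n. a i l) else 0) - a i j) * v j)
      = (\<Sum>j<n. if i = j then (v i)\<^sup>2 * (\<Sum>l<n. a i l) else 0) - (\<Sum>j<n. a i j * (v i * v j))"
      unfolding sum_subtractf[symmetric]
      by (intro sum.cong refl) (simp add: algebra_simps power2_eq_square)
    then show "(\<Sum>j<n. v i * ((if i = j then (\<Sum>l<n. a i l) else 0) - a i j) * v j)
      = (v i)\<^sup>2 * (\<Sum>l<n. a i l) - (\<Sum>j<n. a i j * (v i * v j))"
      using i by simp
  qed
  also have "\<dots> = ?S (\<lambda>i j. (v i)\<^sup>2) - ?S (\<lambda>i j. v i * v j)"
    by (simp add: sum_subtractf sum_distrib_right mult.commute)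
  finally have lhs: "(\<Sum>i<n. \<Sum>j<n. v i * ((if i = j then (\<Sum>l<n. a i l) else 0) - a i j) * v j)
    = ?S (\<lambda>i j. (v i)\<^sup>2) - ?S (\<lambda>i j. v i * v j)" .
  have "?S (\<lambda>i j. (v j)\<^sup>2) = (\<Sum>j<n. \<Sum>i<n. a i j * (v j)\<^sup>2)"
    by (rule sum.swap)
  also have "\<dots> = ?S (\<lambda>i j. (v i)\<^sup>2)"
    by (intro sum.cong refl) (simp add: sym)
  finally have swap: "?S (\<lambda>i j. (v j)\<^sup>2) = ?S (\<lambda>i j. (v i)\<^sup>2)" .
  have "?S (\<lambda>i j. (v i - v j)\<^sup>2)
    = ?S (\<lambda>i j. (v i)\<^sup>2) + ?S (\<lambda>i j. (v j)\<^sup>2) - 2 * ?S (\<lambda>i j. v i * v j)"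
    unfolding sum_distrib_left sum.distrib[symmetric] sum_subtractf[symmetric]
    by (intro sum.cong refl) (simp add: power2_eq_square algebra_simps)
  then show ?thesis
    using lhs swap by simp
qed

subsection \<open>Inequalities for finite sequences\<close>

text \<open>The reflection of the indices negates the summand. Hence the sum over all
  \<open>m\<close> indices is 0, and the tail from \<open>k\<close> on is minus the initial segment
  of length \<open>m - k\<close>. This reduces the theorem to \<open>2 * k \<le> m\<close>.\<close>

lemma sum_reflect_diff_symmetric:
  fixes a :: "nat \<Rightarrow> real"
  assumes "k \<le> m"
  shows "(\<Sum>i<k. a (m - 1 - i) - a i) = (\<Sum>i<m - k. a (m - 1 - i) - a i)"
proof -
  let ?g = "\<lambda>i. a (m - 1 - i) - a i"
  have "(\<Sum>i<m. ?g i) = 0"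
    using sum.nat_diff_reindex[of a m] by (simp add: sum_subtractf)
  moreover have "(\<Sum>i<m. ?g i) = (\<Sum>i<k. ?g i) + (\<Sum>i = k..<m. ?g i)"
    using assms by (simp add: lessThan_atLeast0 sum.atLeastLessThan_concat)
  moreover have "(\<Sum>i = k..<m. ?g i) = (\<Sum>i<m - k. - ?g i)"
    using assms
    by (intro sum.reindex_bij_witness[of _ "\<lambda>i. m - 1 - i" "\<lambda>i. m - 1 - i"]) auto
  ultimately show ?thesis
    by (simp only: sum_negf)
qed

text \<open>Cauchy-Schwarz costs a factor \<open>k\<close> and splitting each difference at
  \<open>c\<close> a factor 2; together they are at most \<open>m\<close>. The centre
  \<open>c\<close> is free here and becomes the mean later.\<close>

lemma sum_reflect_diff_squared_le:
  fixes a :: "nat \<Rightarrow> real"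
  assumes "2 * k \<le> m"
  shows "(\<Sum>i<k. a (m - 1 - i) - a i)\<^sup>2 \<le> m * (\<Sum>i<m. (a i - c)\<^sup>2)"
proof -
  let ?h = "\<lambda>i. (a i - c)\<^sup>2" and ?r = "\<lambda>i. m - 1 - i"
  have "(\<Sum>i<k. a (?r i) - a i)\<^sup>2 \<le> k * (\<Sum>i<k. (a (?r i) - a i)\<^sup>2)"
    using Cauchy_Schwarz_ineq_sum[of "\<lambda>_. 1" "\<lambda>i. a (?r i) - a i" "{..<k}"] by simp
  also have "(\<Sum>i<k. (a (?r i) - a i)\<^sup>2) \<le> (\<Sum>i<k. 2 * (?h (?r i) + ?h i))"
  proof (rule sum_mono)
    fix i
    \<comment> \<open>Parallelogram law: the right side exceeds the left by the square of the sum of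
      the two deviations.\<close>
    show "(a (?r i) - a i)\<^sup>2 \<le> 2 * (?h (?r i) + ?h i)"
      using zero_le_power2[of "(a (?r i) - c) + (a i - c)"]
      by (simp add: power2_eq_square algebra_simps)
  qed
  also have "\<dots> = 2 * (sum ?h (?r ` {..<k}) + sum ?h {..<k})"
  proof -
    have "inj_on ?r {..<k}"
      using assms by (auto simp: inj_on_def)
    then show ?thesis
      by (simp add: sum.reindex sum.distrib flip: sum_distrib_left)
  qed
  \<comment> \<open>Since \<open>2 * k \<le> m\<close>, the first \<open>k\<close> indices and their
    mirror images are disjoint, so no deviation is counted twice.\<close>
  also have "sum ?h (?r ` {..<k}) + sum ?h {..<k} = sum ?h (?r ` {..<k} \<union> {..<k})"
    using assms by (intro sum.union_disjoint[symmetric]) auto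
  also have "\<dots> \<le> (\<Sum>i<m. ?h i)"
    using assms by (intro sum_mono2) auto
  finally have "(\<Sum>i<k. a (?r i) - a i)\<^sup>2 \<le> k * (2 * (\<Sum>i<m. ?h i))"
    by (simp add: mult_left_mono)
  also have "\<dots> = real (2 * k) * (\<Sum>i<m. ?h i)"
    by simp
  also have "\<dots> \<le> real m * (\<Sum>i<m. ?h i)"
    using assms by (intro mult_right_mono of_nat_mono sum_nonneg) auto
  finally show ?thesis .
qed

lemma sum_squared_deviation:
  fixes a :: "nat \<Rightarrow> real"
  shows "(\<Sum>i<n. (a i - c)\<^sup>2) = (\<Sum>i<n. (a i)\<^sup>2) - 2 * c * (\<Sum>i<n. a i) + n * c\<^sup>2"
  by (simp add: power2_diff sum.distrib sum_subtractf sum_distrib_left algebra_simps)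

text \<open>Popoviciu's bound on the variance: around the midpoint \<open>c\<close> of the range
  every squared deviation is at most a quarter of the squared length, and replacing \<open>c\<close>
  by the mean can only decrease the sum.\<close>

lemma sum_squares_le_range:
  fixes d :: "nat \<Rightarrow> real"
  assumes "\<And>i. i < n \<Longrightarrow> lo \<le> d i" "\<And>i. i < n \<Longrightarrow> d i \<le> hi" and "n > 0"
  shows "(\<Sum>i<n. (d i)\<^sup>2) \<le> (\<Sum>i<n. d i)\<^sup>2 / n + n * (hi - lo)\<^sup>2 / 4"
proof -
  define c where "c = (hi + lo) / 2"
  let ?S = "\<Sum>i<n. d i"
  have "(\<Sum>i<n. (d i - c)\<^sup>2) \<le> (\<Sum>i<n. (hi - lo)\<^sup>2 / 4)"
  proof (rule sum_mono)
    fix i assume "i \<in> {..<n}"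
    then have "0 \<le> (d i - lo) * (hi - d i)"
      using assms by (intro mult_nonneg_nonneg) auto
    then show "(d i - c)\<^sup>2 \<le> (hi - lo)\<^sup>2 / 4"
      by (simp add: c_def power2_eq_square field_simps)
  qed
  then have "(\<Sum>i<n. (d i)\<^sup>2) - 2 * c * ?S + n * c\<^sup>2 \<le> n * (hi - lo)\<^sup>2 / 4"
    by (simp add: sum_squared_deviation)
  moreover have "0 \<le> (?S - n * c)\<^sup>2 / n"
    by simp
  then have "0 \<le> ?S\<^sup>2 / n - 2 * c * ?S + n * c\<^sup>2"
    using \<open>n > 0\<close> by (simp add: power2_eq_square field_simps)
  ultimately show ?thesis
    by simp
qed

text \<open>Here \<open>S\<close> is the sum of the degrees and \<open>w\<close> their spread. The
  spread is controlled by the size of \<open>n\<close>, the remaining terms in \<open>S\<close> by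
  completing a square.\<close>

lemma sixteen_variance_less:
  fixes n t w S V :: real
  assumes t: "t > 2" and n: "n \<ge> (11 * t ^ 2 + 8 * t + 4) / (t - 2) ^ 2"
    and w: "0 \<le> w" "w \<le> n / t" and n1: "n > 1"
    and V: "V \<le> S\<^sup>2 / n + n * w\<^sup>2 / 4 + S - S\<^sup>2 / (n - 1)"
  shows "16 * V < (n - 1) * (n + 1)\<^sup>2"
proof -
  \<comment> \<open>The bound on \<open>n\<close> enters as \<open>4 * n / t^2 \<le> n - 3\<close>,
    using \<open>(t - 2)^2 \<le> (t - 2) * (t + 2)\<close>. With \<open>w \<le> n / t\<close> this
    turns the spread term of \<open>16 * V\<close> into at most
    \<open>n^2 * (n - 3)\<close>.\<close>
  have "3 * t\<^sup>2 \<le> 11 * t\<^sup>2 + 8 * t + 4"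
    using t by simp
  also have "\<dots> \<le> n * (t - 2)\<^sup>2"
    using n t by (simp add: field_simps)
  also have "\<dots> \<le> n * (t\<^sup>2 - 4)"
    using n1 t by (intro mult_left_mono) (auto simp: power2_eq_square algebra_simps)
  finally have "4 * n / t\<^sup>2 \<le> n - 3"
    using t by (simp add: field_simps)
  then have "n\<^sup>2 * (4 * n / t\<^sup>2) \<le> n\<^sup>2 * (n - 3)"
    by (rule mult_left_mono) simp
  moreover have "w\<^sup>2 \<le> (n / t)\<^sup>2"
    using w by (rule power_mono[rotated])
  then have "4 * n * w\<^sup>2 \<le> 4 * n * (n / t)\<^sup>2"
    using n1 by (intro mult_left_mono) auto
  ultimately have 1: "4 * n * w\<^sup>2 \<le> n\<^sup>2 * (n - 3)"
    by (simp add: power2_eq_square field_simps)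
  \<comment> \<open>The terms in \<open>S\<close> form a concave quadratic with its maximum
    \<open>n * (n - 1) / 4\<close> at \<open>S = n * (n - 1) / 2\<close>, half the degree sum of the
    complete graph.\<close>
  have "n * (n - 1) / 4 - (S - (S\<^sup>2 / (n - 1) - S\<^sup>2 / n)) = (S - n * (n - 1) / 2)\<^sup>2 / (n * (n - 1))"
    using n1 by (simp add: power2_eq_square field_simps)
  also have "\<dots> \<ge> 0"
    using n1 by simp
  finally have "V \<le> n * w\<^sup>2 / 4 + n * (n - 1) / 4"
    using V by linarith
  then have "16 * V \<le> n\<^sup>2 * (n - 3) + 4 * (n * (n - 1))"
    using 1 by simp
  \<comment> \<open>The right side is larger by exactly \<open>3 * n - 1\<close>.\<close>
  also have "\<dots> < (n - 1) * (n + 1)\<^sup>2"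
    using n1 by (simp add: power2_eq_square algebra_simps)
  finally show ?thesis .
qed

subsection \<open>The Laplacian spectrum of a graph and its complement\<close>

lemma vert_degree_eq_sum:
  assumes "pair_graph G" and f: "bij_betw f {..<card (pverts G)} (pverts G)"
    and i: "i < card (pverts G)"
  shows "real (vert_degree G (f i)) = (\<Sum>j<card (pverts G). if (f i, f j) \<in> parcs G then 1 else 0)"
proof -
  interpret pair_graph G by fact
  let ?J = "{j \<in> {..<card (pverts G)}. (f i, f j) \<in> parcs G}"
  have "out_arcs (with_proj G) (f i) = {e \<in> parcs G. fst e = f i}"
    by (simp add: out_arcs_def)
  also have "\<dots> = (\<lambda>j. (f i, f j)) ` ?J"
  proof -
    have "\<exists>j. j < card (pverts G) \<and> f j = w" if "(f i, w) \<in> parcs G" for w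
      using f arc_snd_in_verts[OF that] unfolding bij_betw_def by (metis imageE lessThan_iff snd_conv)
    then show ?thesis
      by (force simp: image_iff)
  qed
  finally have "vert_degree G (f i) = card ((\<lambda>j. (f i, f j)) ` ?J)"
    by (simp add: vert_degree_def out_degree_def)
  also have "\<dots> = card ?J"
    using f by (intro card_image) (auto simp: bij_betw_def inj_on_def)
  finally show ?thesis
    by (simp add: sum.If_cases) (simp add: Int_def)
qed

text \<open>The choice depends on the vertex set alone, so both Laplacians use the same enumeration
  and can be compared entry by entry.\<close>

lemma vertex_enum_complement: "vertex_enum (graph_complement G) = vertex_enum G"
  by (simp add: vertex_enum_def graph_complement_def)

lemma pverts_complement [simp]: "pverts (graph_complement G) = pverts G"
  by (simp add: graph_complement_def)

section \<open>Laplacian entries, row sums and traces in terms of adjacency\<close>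

definition adj :: "'a pair_pre_digraph \<Rightarrow> nat \<Rightarrow> nat \<Rightarrow> real" where
  "adj G i j = (if (vertex_enum G i, vertex_enum G j) \<in> parcs G then 1 else 0)"

lemma adj_sym:
  assumes "pair_graph G"
  shows "adj G i j = adj G j i"
proof -
  interpret pair_graph G by fact
  have "(u, v) \<in> parcs G \<longleftrightarrow> (v, u) \<in> parcs G" for u v
    using pair_sym_arcs by (auto simp: symmetric_def elim: symE)
  then show ?thesis
    by (simp add: adj_def)
qed

lemma adj_self:
  assumes "pair_graph G"
  shows "adj G i i = 0"
proof -
  interpret pair_graph G by fact
  show ?thesis
    using pair_no_loops by (fastforce simp: adj_def)
qed

lemma adj_squared: "(adj G i j)\<^sup>2 = adj G i j"
  by (simp add: adj_def)

lemma vert_degree_eq_sum_adj: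
  assumes "pair_graph G" "i < card (pverts G)"
  shows "real (vert_degree G (vertex_enum G i)) = (\<Sum>j<card (pverts G). adj G i j)"
  using vert_degree_eq_sum[OF assms(1) bij_betw_vertex_enum[OF assms(1)] assms(2)]
  by (simp add: adj_def)

lemma adj_complement:
  assumes "pair_graph G" "i < card (pverts G)" "j < card (pverts G)"
  shows "adj (graph_complement G) i j = 1 - (if i = j then 1 else 0) - adj G i j"
proof -
  have b: "bij_betw (vertex_enum G) {..<card (pverts G)} (pverts G)"
    by (rule bij_betw_vertex_enum[OF assms(1)])
  have "vertex_enum G i = vertex_enum G j \<longleftrightarrow> i = j"
    using b assms(2,3) by (auto simp: bij_betw_def inj_on_def)
  moreover have "vertex_enum G i \<in> pverts G" "vertex_enum G j \<in> pverts G"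
    using b assms(2,3) by (auto simp: bij_betw_def)
  moreover have "i = j \<Longrightarrow> adj G i j = 0"
    using adj_self[OF assms(1)] by simp
  ultimately show ?thesis
    unfolding adj_def vertex_enum_complement by (auto simp: graph_complement_def)
qed

lemma laplacian_carrier: "laplacian G \<in> carrier_mat (card (pverts G)) (card (pverts G))"
  unfolding laplacian_def by (rule laplacian_mat_carrier)

lemma laplacian_index:
  assumes "pair_graph G" "i < card (pverts G)" "j < card (pverts G)"
  shows "laplacian G $$ (i, j) =
    (if i = j then \<Sum>l<card (pverts G). adj G i l else 0) - adj G i j"
  unfolding laplacian_def laplacian_mat_index[OF assms(2,3)]
  using vert_degree_eq_sum_adj[OF assms(1,2)] by (auto simp: adj_def)

text \<open>The two adjacency matrices add up to the all-ones matrix minus the identity, and the two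
  degrees of a vertex to \<open>n - 1\<close>.\<close>

lemma laplacian_complement_index:
  assumes "pair_graph G" "i < card (pverts G)" "j < card (pverts G)"
  shows "laplacian (graph_complement G) $$ (i, j) =
    (if i = j then real (card (pverts G)) else 0) - 1 - laplacian G $$ (i, j)"
proof -
  let ?n = "card (pverts G)"
  have "(\<Sum>l<?n. adj (graph_complement G) i l)
    = (\<Sum>l<?n. 1 - (if i = l then 1 else 0) - adj G i l)"
    using adj_complement[OF assms(1,2)] by (intro sum.cong) auto
  also have "\<dots> = ?n - 1 - (\<Sum>l<?n. adj G i l)"
    using assms(2) by (simp add: sum_subtractf)
  finally show ?thesis
    using laplacian_index[OF pair_graph_complement[OF assms(1)], of i j]
      laplacian_index[OF assms] adj_complement[OF assms] assms(2,3) by auto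
qed

lemma laplacian_row_sum:
  assumes "pair_graph G" "i < card (pverts G)"
  shows "(\<Sum>j<card (pverts G). laplacian G $$ (i, j)) = 0"
proof -
  have "(\<Sum>j<card (pverts G). laplacian G $$ (i, j))
    = (\<Sum>j<card (pverts G). (if i = j then \<Sum>l<card (pverts G). adj G i l else 0) - adj G i j)"
    using laplacian_index[OF assms] by (intro sum.cong) auto
  then show ?thesis
    using assms(2) by (simp add: sum_subtractf)
qed

lemma laplacian_sym:
  assumes "pair_graph G" "i < card (pverts G)" "j < card (pverts G)"
  shows "laplacian G $$ (i, j) = laplacian G $$ (j, i)"
  using laplacian_index[OF assms] laplacian_index[OF assms(1,3,2)] adj_sym[OF assms(1), of i j]
  by auto

lemma laplacian_eigenvalue_nonneg:
  assumes G: "pair_graph G" and root: "poly (char_poly (laplacian G)) e = 0"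
  shows "e \<ge> 0"
proof (rule eigenvalue_nonneg_if_quadratic_form_nonneg[OF laplacian_carrier _ root])
  fix v :: "real vec"
  let ?n = "card (pverts G)"
  assume v: "v \<in> carrier_vec ?n"
  have "v \<bullet> (laplacian G *\<^sub>v v) = (\<Sum>i<?n. \<Sum>j<?n. v $ i * laplacian G $$ (i, j) * v $ j)"
    using v laplacian_carrier[of G]
    by (simp add: scalar_prod_def atLeast0LessThan sum_distrib_left mult.assoc)
  also have "\<dots> = (\<Sum>i<?n. \<Sum>j<?n.
      v $ i * ((if i = j then (\<Sum>l<?n. adj G i l) else 0) - adj G i j) * v $ j)"
    using laplacian_index[OF G] by (intro sum.cong refl) simp
  also have "\<dots> = (\<Sum>i<?n. \<Sum>j<?n. adj G i j * (v $ i - v $ j)\<^sup>2) / 2"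
    by (rule laplacian_quadratic_form) (rule adj_sym[OF G])
  also have "\<dots> \<ge> 0"
    by (auto simp: adj_def intro!: sum_nonneg)
  finally show "v \<bullet> (laplacian G *\<^sub>v v) \<ge> 0" .
qed

text \<open>By symmetry the trace of the square is the sum of all squared entries: the diagonal
  gives the squared degrees, and the off-diagonal entries, being 0 or -1, count the arcs, that is,
  the degree sum once more.\<close>

lemma mat_trace_laplacian:
  assumes G: "pair_graph G"
  defines "n \<equiv> card (pverts G)"
  defines "d \<equiv> \<lambda>i. real (vert_degree G (vertex_enum G i))"
  shows "mat_trace (laplacian G) = (\<Sum>i<n. d i)"
    and "mat_trace (laplacian G * laplacian G) = (\<Sum>i<n. (d i)\<^sup>2) + (\<Sum>i<n. d i)"
proof -
  have L: "laplacian G \<in> carrier_mat n n"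
    unfolding n_def by (rule laplacian_carrier)
  have d: "d i = (\<Sum>l<n. adj G i l)" if "i < n" for i
    using vert_degree_eq_sum_adj[OF G, of i] that by (simp add: d_def n_def)
  have ind: "laplacian G $$ (i, j) = (if i = j then d i else 0) - adj G i j"
    if "i < n" "j < n" for i j
    using laplacian_index[OF G, of i j] that d by (simp add: n_def)
  show "mat_trace (laplacian G) = (\<Sum>i<n. d i)"
    using L ind adj_self[OF G] by (simp add: mat_trace_def)
  have "mat_trace (laplacian G * laplacian G)
    = (\<Sum>i<n. \<Sum>j<n. laplacian G $$ (i, j) * laplacian G $$ (j, i))"
    by (rule mat_trace_mult[OF L L])
  also have "\<dots> = (\<Sum>i<n. \<Sum>j<n. (if i = j then (d i)\<^sup>2 else 0) + adj G i j)"
  proof (intro sum.cong refl)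
    fix i j assume "i \<in> {..<n}" "j \<in> {..<n}"
    then show "laplacian G $$ (i, j) * laplacian G $$ (j, i)
      = (if i = j then (d i)\<^sup>2 else 0) + adj G i j"
      using ind[of i j] ind[of j i] adj_self[OF G] adj_sym[OF G, of j i] adj_squared[of G i j]
      by (auto simp: power2_eq_square)
  qed
  also have "\<dots> = (\<Sum>i<n. (d i)\<^sup>2) + (\<Sum>i<n. d i)"
    using d by (simp add: sum.distrib)
  finally show "mat_trace (laplacian G * laplacian G) = (\<Sum>i<n. (d i)\<^sup>2) + (\<Sum>i<n. d i)" .
qed

text \<open>As 0 is a least eigenvalue, it heads the ascending list and comes last after
  \<open>rev\<close>.\<close>

lemma laplacian_eigenvalues_eqI:
  assumes "char_poly (laplacian G) = (\<Prod>a\<leftarrow>0 # es. [:- a, 1:])"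
    and "sorted es" and "\<And>e. e \<in> set es \<Longrightarrow> 0 \<le> e"
  shows "laplacian_eigenvalues G = rev es @ [0]"
proof -
  have "sorted (0 # es)"
    using assms(2,3) by simp
  then have "sort (0 # es) = 0 # es"
    by (rule sorted_sort_id)
  then show ?thesis
    unfolding laplacian_eigenvalues_def assms(1) proots_prod_list_linear sorted_list_of_multiset_mset
    by simp
qed

text \<open>Both Laplacians annihilate the all-ones vector. Modulo that vector the all-ones matrix
  disappears, so the complement acts there as \<open>n\<close> minus the Laplacian of
  \<open>G\<close>. Nonnegativity of both spectra puts the split-off 0 last in both lists, and
  \<open>e \<mapsto> n - e\<close> turns the ascending \<open>es\<close> into a descending
  list.\<close>

lemma laplacian_spectrum_complement:
  assumes G: "pair_graph G" and n: "card (pverts G) = Suc m"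
  obtains es :: "real list" where "length es = m"
    and "char_poly (laplacian G) = (\<Prod>a\<leftarrow>0 # es. [:- a, 1:])"
    and "laplacian_eigenvalues G = rev es @ [0]"
    and "laplacian_eigenvalues (graph_complement G) = map (\<lambda>e. real (Suc m) - e) es @ [0]"
proof -
  let ?G' = "graph_complement G"
  let ?R = "row_reduced_mat m (laplacian G)"
  let ?R' = "row_reduced_mat m (laplacian ?G')"
  let ?lin = "\<lambda>xs. \<Prod>a\<leftarrow>xs. [:- a, 1:] :: real poly"
  have G': "pair_graph ?G'"
    by (rule pair_graph_complement[OF G])
  have block: "char_poly (laplacian H) = [:- 0, 1:] * char_poly (row_reduced_mat m (laplacian H))"
    if "pair_graph H" "card (pverts H) = Suc m" for H :: "'a pair_pre_digraph"
  proof -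
    have "monom 1 1 = ([:- 0, 1:] :: real poly)"
      by (simp add: monom_altdef)
    then show ?thesis
      using char_poly_zero_row_sums[of "laplacian H" m] laplacian_carrier[of H]
        laplacian_row_sum[OF that(1)] that(2) by metis
  qed
  have R: "?R \<in> carrier_mat m m"
    by (rule row_reduced_mat_carrier)
  have deg: "degree (char_poly ?R) = m" "lead_coeff (char_poly ?R) = 1"
    using degree_monic_char_poly[OF R] by auto
  have "char_poly ?R \<noteq> 0"
    using deg(2) by auto
  \<comment> \<open>The reduced matrix need not be symmetric, so its real-rootedness is inherited
    from the Laplacian: of the \<open>m + 1\<close> real roots, one is the split-off 0.\<close>
  have "size (proots (char_poly (laplacian G))) = Suc m"
    using size_proots_symmetric[OF laplacian_carrier laplacian_sym[OF G]] n by simp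
  moreover have "proots (char_poly (laplacian G)) = {#0#} + proots (char_poly ?R)"
    unfolding block[OF G n] using \<open>char_poly ?R \<noteq> 0\<close> by (subst proots_mult) auto
  ultimately obtain es0 where es0: "char_poly ?R = ?lin es0"
    using poly_splits_if_size_proots[of "char_poly ?R"] deg by auto
  define es where "es = sort es0"
  have "?lin es = prod_mset (image_mset (\<lambda>a. [:- a, 1:]) (mset es))" for es
    by (simp flip: prod_mset_prod_list)
  then have es: "char_poly ?R = ?lin es"
    unfolding es0 by (simp add: es_def)
  have len: "length es = m"
    using deg(1) proots_prod_list_linear[of es] unfolding es
    by (simp add: degree_linear_factors)
  \<comment> \<open>The constant \<open>- 1\<close> in the entries of the complement cancels in the
    row differences.\<close>
  have "?R' = real (Suc m) \<cdot>\<^sub>m 1\<^sub>m m - ?R"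
    using n by (intro eq_matI)
      (auto simp: row_reduced_mat_def laplacian_complement_index[OF G])
  then have R': "char_poly ?R' = ?lin (map (\<lambda>e. real (Suc m) - e) es)"
    using char_poly_reflect[OF R es, of "Suc m"] by (simp add: o_def)
  have cp: "char_poly (laplacian G) = ?lin (0 # es)"
    unfolding block[OF G n] es by simp
  have "?lin (rev xs) = ?lin xs" for xs
    by (simp flip: rev_map)
  then have cp': "char_poly (laplacian ?G') = ?lin (0 # rev (map (\<lambda>e. real (Suc m) - e) es))"
    using block[OF G'] n R' by simp
  have nonneg: "0 \<le> e" if "char_poly (laplacian H) = ?lin xs" "pair_graph H" "e \<in> set xs"
    for H :: "'a pair_pre_digraph" and xs e
    using laplacian_eigenvalue_nonneg[OF that(2), of e] that(1,3)
    by (auto simp: poly_prod_list prod_list_zero_iff image_iff)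
  show thesis
  proof (rule that[OF len cp])
    show "laplacian_eigenvalues G = rev es @ [0]"
      using cp G by (intro laplacian_eigenvalues_eqI nonneg[OF cp G]) (auto simp: es_def)
    have "sorted (rev (map (\<lambda>e. real (Suc m) - e) es))"
      using sorted_sort[of es0] unfolding es_def[symmetric]
      by (induction es) (auto simp: sorted_append)
    then show "laplacian_eigenvalues ?G' = map (\<lambda>e. real (Suc m) - e) es @ [0]"
      using laplacian_eigenvalues_eqI[OF cp'] nonneg[OF cp' G'] by simp
  qed
qed

section \<open>Combining spectrum, traces and the variance bound\<close>

theorem theorem3p9:
  fixes G :: "'a pair_pre_digraph" and n k :: nat and t :: real
  assumes "pair_graph G"
    and "n = card (pverts G)"
    and "t > 2"
    and "real n \<ge> (11 * t ^ 2 + 8 * t + 4) / (t - 2) ^ 2"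
    and "real (max_degree G) - real (min_degree G) \<le> real n / t"
    and "k \<in> {1..n - 2}"
  shows "laplacian_sum k G + laplacian_sum k (graph_complement G)
    < real (n choose 2) + 2 * real ((k + 1) choose 2)"
proof -
  interpret pair_graph G by fact
  \<comment> \<open>\<open>m\<close> counts the eigenvalues besides the split-off 0. As
    \<open>k < m\<close>, the first \<open>k\<close> entries of both lists lie before the trailing
    0.\<close>
  obtain m where m: "n = Suc m" "k < m" "m > 1"
    using assms(6) by (cases n) auto
  obtain es :: "real list" where len: "length es = m"
    and cp: "char_poly (laplacian G) = (\<Prod>a\<leftarrow>0 # es. [:- a, 1:])"
    and ev: "laplacian_eigenvalues G = rev es @ [0]"
    and ev': "laplacian_eigenvalues (graph_complement G) = map (\<lambda>e. real (Suc m) - e) es @ [0]"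
    using laplacian_spectrum_complement[OF assms(1)] assms(2) m(1) by metis
  define a where "a i = es ! i" for i
  define F where "F k = (\<Sum>i<k. a (m - 1 - i) - a i)" for k
  have shift: "(\<Sum>i = 1..k. g (i - 1)) = (\<Sum>i<k. g i)" for g :: "nat \<Rightarrow> real"
    by (rule sum.reindex_bij_witness[of _ Suc "\<lambda>i. i - 1"]) auto
  have "laplacian_sum k G = (\<Sum>i<k. a (m - 1 - i))"
    unfolding laplacian_sum_def mu_def ev shift
    using len m by (intro sum.cong refl) (auto simp: nth_append rev_nth a_def)
  moreover have "laplacian_sum k (graph_complement G) = (\<Sum>i<k. n - a i)"
    unfolding laplacian_sum_def mu_def ev' shift
    using len m by (intro sum.cong refl) (auto simp: nth_append a_def)
  ultimately have sum_eq: "laplacian_sum k G + laplacian_sum k (graph_complement G) = n * k + F k"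
    by (simp add: F_def sum_subtractf)

  define d where "d i = real (vert_degree G (vertex_enum G i))" for i
  define S where "S = (\<Sum>i<n. d i)"
  define w where "w = real (max_degree G) - real (min_degree G)"
  \<comment> \<open>\<open>S / m\<close> is the mean of the \<open>a i\<close>: their sum is the
    trace of the Laplacian, which is the degree sum \<open>S\<close>.\<close>
  define V where "V = (\<Sum>i<m. (a i - S / m)\<^sup>2)"
  note tr = mat_trace_laplacian[OF assms(1), folded assms(2) d_def S_def]
    and tr_ev = mat_trace_eigenvalues[OF laplacian_carrier cp]
  have list_sum: "(\<Sum>e\<leftarrow>es. g e) = (\<Sum>i<m. g (a i))" for g :: "real \<Rightarrow> real"
    using len by (simp add: sum_list_sum_nth a_def atLeast0LessThan)
  have sum_a: "(\<Sum>i<m. a i) = S"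
    using tr(1) tr_ev(1) list_sum[of "\<lambda>x. x"] by simp
  have sum_a2: "(\<Sum>i<m. (a i)\<^sup>2) = (\<Sum>i<n. (d i)\<^sup>2) + S"
    using tr(2) tr_ev(2) list_sum[of "\<lambda>x. x\<^sup>2"] by simp
  have "V = (\<Sum>i<m. (a i)\<^sup>2) - 2 * (S / m) * S + m * (S / m)\<^sup>2"
    unfolding V_def sum_squared_deviation sum_a ..
  also have "\<dots> = (\<Sum>i<n. (d i)\<^sup>2) + S - S\<^sup>2 / m"
    unfolding sum_a2 using m(3) by (simp add: power2_eq_square field_simps)
  finally have V_eq: "V = (\<Sum>i<n. (d i)\<^sup>2) + S - S\<^sup>2 / m" .
  have d_range: "real (min_degree G) \<le> d i" "d i \<le> real (max_degree G)" if "i < n" for i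
  proof -
    have "vertex_enum G i \<in> pverts G"
      using bij_betw_vertex_enum[OF assms(1)] that assms(2) by (auto simp: bij_betw_def)
    then show "real (min_degree G) \<le> d i" "d i \<le> real (max_degree G)"
      using pair_finite_verts by (auto simp: d_def min_degree_def max_degree_def)
  qed
  then have "(\<Sum>i<n. (d i)\<^sup>2) \<le> S\<^sup>2 / n + n * w\<^sup>2 / 4"
    unfolding S_def w_def by (intro sum_squares_le_range) (use m in auto)
  moreover have "0 \<le> w"
    using d_range[of 0] m by (simp add: w_def)
  ultimately have V_less: "16 * V < real m * (real m + 2)\<^sup>2"
    using sixteen_variance_less[of t "real n" w V S] assms(3-5) V_eq m by (simp add: w_def add.commute)

  \<comment> \<open>The square of \<open>F j\<close> is at most \<open>m * V\<close>, and
    \<open>V_less\<close> makes \<open>16 * m * V\<close> smaller than the square of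
    \<open>m * (m + 2)\<close>.\<close>
  have F_less: "4 * F j < real m * (real m + 2)" if j: "2 * j \<le> m" for j
  proof -
    have "(4 * F j)\<^sup>2 \<le> 16 * (m * V)"
      using sum_reflect_diff_squared_le[OF j, of a "S / m"] by (simp add: F_def V_def)
    also have "\<dots> < (real m * (real m + 2))\<^sup>2"
      using mult_strict_left_mono[OF V_less, of "real m"] m by (simp add: power2_eq_square mult_ac)
    finally show ?thesis
      by (rule power2_less_imp_less) simp
  qed
  have "4 * F k < real m * (real m + 2)"
  proof (cases "2 * k \<le> m")
    case False
    then show ?thesis
      using F_less[of "m - k"] sum_reflect_diff_symmetric[of k m a] m by (simp add: F_def)
  qed (rule F_less)
  \<comment> \<open>This is \<open>k * (m - k) \<le> m^2 / 4\<close>. Added to the bound on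
    \<open>F k\<close> it gives \<open>k * (m - k) + F k < m * (m + 1) / 2\<close>, and
    \<open>n * k - k * (k + 1) = k * (m - k)\<close>.\<close>
  moreover have "0 \<le> (real m - 2 * real k)\<^sup>2"
    by simp
  ultimately have "n * k + F k < real n * real m / 2 + real k * (real k + 1)"
    unfolding m by (simp add: power2_eq_square field_simps)
  moreover have "real (n choose 2) = real n * real m / 2"
    "2 * real ((k + 1) choose 2) = real k * (real k + 1)"
    using m by (simp_all add: choose_two real_of_nat_div algebra_simps)
  ultimately show ?thesis
    using sum_eq by simp
qed

end
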